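(* Let $q\ge 0$ be an integer, let $x_0,\dots,x_q\in\mathbb{C}$ and let $\tau\in\mathbb{R}$. Then $$\sum_{j=0}^q x_j\,e^{-\tau[x_0,\dots,x_q,x_j]}=\left(\tau\frac{\partial}{\partial\tau}-q\right)e^{-\tau[x_0,\dots,x_q]}.$$
   Context: For a number $t$ and nodes $z_0,\dots,z_m\in\mathbb{C}$, $e^{t[z_0,\dots,z_m]}$ denotes the divided difference $f[z_0,\dots,z_m]$ of the function $f(x)=e^{tx}$ at the nodes $z_0,\dots,z_m$ (not the exponential of a divided difference). Here, for holomorphic $f$, $f[z_0,\dots,z_m]=\frac{1}{2\pi i}\oint_\Gamma\frac{f(z)}{\prod_{i=0}^m(z-z_i)}\,dz$ with $\Gamma$ a positively oriented contour enclosing all the $z_i$; for pairwise distinct nodes this equals $\sum_{i=0}^m f(z_i)/\prod_{k\ne i}(z_i-z_k)$. Nodes may be repeated; $[x_0,\dots,x_q,x_j]$ is the list $x_0,\dots,x_q$ with $x_j$ appended once more. *)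

theory Defs
  imports "HOL-Complex_Analysis.Complex_Analysis"
begin

definition pos_contour_enclosing :: "(real \<Rightarrow> complex) \<Rightarrow> complex set \<Rightarrow> bool" where
  "pos_contour_enclosing \<gamma> A \<longleftrightarrow>
     valid_path \<gamma> \<and> simple_path \<gamma> \<and> pathfinish \<gamma> = pathstart \<gamma> \<and>
     A \<subseteq> inside (path_image \<gamma>) \<and>
     (\<forall>z \<in> inside (path_image \<gamma>). winding_number \<gamma> z = 1)"

text \<open>
  The nodes form a list, so repetitions count with multiplicity. The contour is not required to
  stay inside a domain of holomorphy, so the definition is intended for entire functions \<open>f\<close>; for
  these the choice of the contour is immaterial, see \<open>divided_difference_eq\<close> below.
\<close>

definition divided_difference :: "(complex \<Rightarrow> complex) \<Rightarrow> complex list \<Rightarrow> complex" where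
  "divided_difference f zs =
     1 / (2 * of_real pi * \<i>) *
     contour_integral (SOME \<gamma>. pos_contour_enclosing \<gamma> (set zs))
       (\<lambda>z. f z / (\<Prod>w\<leftarrow>zs. (z - w)))"

definition exp_divided_difference :: "complex \<Rightarrow> complex list \<Rightarrow> complex" where
  "exp_divided_difference t zs = divided_difference (\<lambda>x. exp (t * x)) zs"

lemma pos_contour_enclosing_circlepath:
  assumes "0 < r" and A: "A \<subseteq> ball c r"
  shows "pos_contour_enclosing (circlepath c r) A"
proof -
  have sp: "simple_path (circlepath c r)"
    using assms by (simp add: simple_path_circlepath)
  have pim: "path_image (circlepath c r) = sphere c r"
    using assms by simp
  have sub: "ball c r \<subseteq> inside (sphere c r)"
    using interior_inside_frontier[of "cball c r"] assms by simp
  have c_in: "c \<in> inside (path_image (circlepath c r))"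
    using sub assms unfolding pim by auto
  have "winding_number (circlepath c r) z = 1" if "z \<in> inside (path_image (circlepath c r))" for z
  proof (rule simple_closed_path_winding_number_inside[OF sp])
    assume "\<And>z. z \<in> inside (path_image (circlepath c r)) \<Longrightarrow> winding_number (circlepath c r) z = -1"
    then show ?thesis
      using c_in winding_number_circlepath_centre[OF assms(1), of c] by fastforce
  qed (use that in blast)
  then show ?thesis
    unfolding pos_contour_enclosing_def using sp sub A pim by auto
qed

lemma ex_pos_contour_enclosing:
  assumes "finite A"
  shows "\<exists>\<gamma>. pos_contour_enclosing \<gamma> A"
proof -
  obtain r where "0 < r" "A \<subseteq> ball 0 r"
    using bounded_subset_ballD[OF finite_imp_bounded[OF assms], of 0] by blast
  then show ?thesis
    by (intro exI[of _ "circlepath 0 r"] pos_contour_enclosing_circlepath)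
qed

lemma contour_integral_pos_contour_enclosing:
  assumes f: "f holomorphic_on UNIV" and \<gamma>: "pos_contour_enclosing \<gamma> (set zs)"
  shows "contour_integral \<gamma> (\<lambda>z. f z / (\<Prod>w\<leftarrow>zs. (z - w))) =
     2 * of_real pi * \<i> * (\<Sum>p\<in>set zs. residue (\<lambda>z. f z / (\<Prod>w\<leftarrow>zs. (z - w))) p)"
proof -
  have prod_holo: "(\<lambda>z. \<Prod>w\<leftarrow>ws. (z - w)) holomorphic_on UNIV" for ws :: "complex list"
    by (induction ws) (auto intro!: holomorphic_intros)
  have holo: "(\<lambda>z. f z / (\<Prod>w\<leftarrow>zs. (z - w))) holomorphic_on UNIV - set zs"
    by (intro holomorphic_on_divide holomorphic_on_subset[OF f] holomorphic_on_subset[OF prod_holo])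
       (auto simp: prod_list_zero_iff)
  have w: "winding_number \<gamma> p = 1" if "p \<in> set zs" for p
    using \<gamma> that unfolding pos_contour_enclosing_def by blast
  have "path_image \<gamma> \<subseteq> UNIV - set zs"
    using \<gamma> inside_no_overlap[of "path_image \<gamma>"] unfolding pos_contour_enclosing_def by blast
  then have "contour_integral \<gamma> (\<lambda>z. f z / (\<Prod>w\<leftarrow>zs. (z - w))) =
     of_real (2 * pi) * \<i> *
       (\<Sum>p\<in>set zs. winding_number \<gamma> p * residue (\<lambda>z. f z / (\<Prod>w\<leftarrow>zs. (z - w))) p)"
    using \<gamma> unfolding pos_contour_enclosing_def
    by (intro Residue_theorem[OF open_UNIV connected_UNIV _ holo]) auto
  then show ?thesis
    using w by simp
qed

lemma divided_difference_eq:
  assumes "f holomorphic_on UNIV" and "pos_contour_enclosing \<gamma> (set zs)"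
  shows "divided_difference f zs =
     1 / (2 * of_real pi * \<i>) * contour_integral \<gamma> (\<lambda>z. f z / (\<Prod>w\<leftarrow>zs. (z - w)))"
proof -
  have "pos_contour_enclosing (SOME \<gamma>. pos_contour_enclosing \<gamma> (set zs)) (set zs)"
    by (rule someI_ex[OF ex_pos_contour_enclosing[OF finite_set]])
  then show ?thesis
    unfolding divided_difference_def
    by (simp only: contour_integral_pos_contour_enclosing[OF assms(1)] assms(2))
qed

lemma divided_difference_distinct:
  assumes f: "f holomorphic_on UNIV" and "distinct zs"
  shows "divided_difference f zs = (\<Sum>p\<in>set zs. f p / (\<Prod>w\<in>set zs - {p}. (p - w)))"
proof -
  have pr: "(\<Prod>w\<leftarrow>zs. (z - w)) = (\<Prod>w\<in>set zs. (z - w))" for z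
    using assms(2) by (simp add: prod.distinct_set_conv_list)
  have res: "residue (\<lambda>z. f z / (\<Prod>w\<leftarrow>zs. (z - w))) p = f p / (\<Prod>w\<in>set zs - {p}. (p - w))"
    if p: "p \<in> set zs" for p
  proof -
    let ?S = "- (set zs - {p})"
    let ?g = "\<lambda>z. f z / (\<Prod>w\<in>set zs - {p}. (z - w))"
    have "(\<lambda>z. f z / (\<Prod>w\<leftarrow>zs. (z - w))) = (\<lambda>z. ?g z / (z - p))"
      using p by (simp add: pr prod.remove[of _ p] mult.commute)
    moreover have "?g holomorphic_on ?S"
      by (intro holomorphic_intros holomorphic_on_subset[OF f]) auto
    moreover have "open ?S"
      by (intro open_Compl finite_imp_closed) simp
    ultimately show ?thesis
      using residue_simple[of ?S p ?g] by simp
  qed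
  obtain \<gamma> where "pos_contour_enclosing \<gamma> (set zs)"
    using ex_pos_contour_enclosing[of "set zs"] by auto
  then show ?thesis
    using res by (simp add: divided_difference_eq[OF f] contour_integral_pos_contour_enclosing[OF f])
qed

end

theory Submission
  imports Defs
begin

text \<open>
  Put \<open>P(z) = \<Prod>(z - x\<^sub>j)\<close> and \<open>F(s) = 1/(2\<pi>i) \<oint> e\<^bsup>sz\<^esup>/P(z) dz\<close>, so that
  \<open>F'(s) = 1/(2\<pi>i) \<oint> z e\<^bsup>sz\<^esup>/P(z) dz\<close>. Since
  \<open>(z e\<^bsup>sz\<^esup>/P)' = e\<^bsup>sz\<^esup>/P (1 + s z - \<Sum> z/(z - x\<^sub>j))\<close> integrates to zero along a closed contour
  and \<open>x\<^sub>j/(z - x\<^sub>j) = z/(z - x\<^sub>j) - 1\<close>, summing over the \<open>q + 1\<close> nodes gives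
  \<open>\<Sum> x\<^sub>j/(2\<pi>i) \<oint> e\<^bsup>sz\<^esup>/(P(z)(z - x\<^sub>j)) dz = F(s) + s F'(s) - (q + 1) F(s)\<close>.
\<close>

text \<open>Product rule, one factor at a time, in logarithmic form. A repeated node contributes one
  summand per occurrence, so multiplicities need no separate treatment.\<close>

lemma has_field_derivative_prod_list_diff:
  fixes z :: "'a::real_normed_field"
  assumes "z \<notin> set zs"
  shows "((\<lambda>z. \<Prod>w\<leftarrow>zs. (z - w)) has_field_derivative
           (\<Prod>w\<leftarrow>zs. (z - w)) * (\<Sum>w\<leftarrow>zs. 1 / (z - w))) (at z)"
  using assms
proof (induction zs)
  case (Cons a zs)
  have "((\<lambda>z. (z - a) * (\<Prod>w\<leftarrow>zs. (z - w))) has_field_derivative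
      1 * (\<Prod>w\<leftarrow>zs. (z - w)) +
      (\<Prod>w\<leftarrow>zs. (z - w)) * (\<Sum>w\<leftarrow>zs. 1 / (z - w)) * (z - a)) (at z)"
    using Cons by (intro DERIV_mult) (auto intro!: derivative_eq_intros)
  moreover have "1 * p + p * S * (z - a) = (z - a) * p * (1 / (z - a) + S)" for p S
    using Cons.prems by (simp add: distrib_left)
  ultimately show ?case
    by simp
qed simp

lemma has_contour_integral_sum_list:
  assumes "\<And>w. w \<in> set ws \<Longrightarrow> (f w has_contour_integral I w) \<gamma>"
  shows "((\<lambda>z. \<Sum>w\<leftarrow>ws. f w z) has_contour_integral (\<Sum>w\<leftarrow>ws. I w)) \<gamma>"
  using assms by (induction ws) (auto intro: has_contour_integral_add has_contour_integral_0)

text \<open>Differentiation under the integral sign: the circle turns this into an integral over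
  [0,1] whose s-derivative is jointly continuous in s and the path parameter. It is applied with
  \<open>g\<close> = 1/P.\<close>

lemma has_field_derivative_contour_integral_exp:
  assumes "continuous_on (path_image (circlepath c r)) g"
  shows "((\<lambda>s. contour_integral (circlepath c r) (\<lambda>z. exp (s * z) * g z)) has_field_derivative
           contour_integral (circlepath c r) (\<lambda>z. z * exp (s * z) * g z)) (at s)"
proof -
  let ?\<gamma> = "circlepath c r"
  \<comment> \<open>The velocity of the circle, as in
    \<open>vector_derivative_circlepath\<close>.\<close>
  let ?v = "\<lambda>u::real. 2 * pi * \<i> * r * exp (2 * of_real pi * \<i> * u)"
  have \<gamma>: "continuous_on {0..1} ?\<gamma>"
    using path_circlepath[of c r] by (simp add: path_def)
  have g: "continuous_on {0..1} (\<lambda>u. g (?\<gamma> u))"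
    using continuous_on_compose[OF \<gamma>] assms by (simp add: path_image_def o_def)
  have snd: "continuous_on (UNIV \<times> {0..1}) (\<lambda>p::complex \<times> real. h (snd p))"
    if "continuous_on {0..1} h" for h :: "real \<Rightarrow> complex"
    by (rule continuous_on_compose2[OF that]) (auto intro!: continuous_intros)
  have "((\<lambda>s. integral (cbox 0 1) (\<lambda>u. exp (s * ?\<gamma> u) * g (?\<gamma> u) * ?v u)) has_field_derivative
      integral (cbox 0 1) (\<lambda>u. ?\<gamma> u * exp (s * ?\<gamma> u) * g (?\<gamma> u) * ?v u)) (at s within UNIV)"
  proof (rule leibniz_rule_field_derivative)
    fix s :: complex and u :: real
    show "((\<lambda>s. exp (s * ?\<gamma> u) * g (?\<gamma> u) * ?v u) has_field_derivative
        ?\<gamma> u * exp (s * ?\<gamma> u) * g (?\<gamma> u) * ?v u) (at s within UNIV)"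
      by (auto intro!: derivative_eq_intros)
    show "(\<lambda>u. exp (s * ?\<gamma> u) * g (?\<gamma> u) * ?v u) integrable_on cbox 0 1"
      using \<gamma> g by (intro integrable_continuous) (auto intro!: continuous_intros)
  next
    show "continuous_on (UNIV \<times> cbox 0 1)
        (\<lambda>(s, u). ?\<gamma> u * exp (s * ?\<gamma> u) * g (?\<gamma> u) * ?v u)"
      using snd[OF \<gamma>] snd[OF g]
      by (auto simp: split_beta intro!: continuous_intros)
  qed auto
  then show ?thesis
    by (simp add: contour_integral_integral vector_derivative_circlepath)
qed

text \<open>Trades the contour picked by \<open>SOME\<close> for an explicit circle, which can be
  differentiated through and shared by all node lists inside the ball.\<close>

lemma exp_divided_difference_circlepath:
  assumes "0 < r" and "set zs \<subseteq> ball c r"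
  shows "exp_divided_difference s zs =
    1 / (2 * of_real pi * \<i>) *
      contour_integral (circlepath c r) (\<lambda>z. exp (s * z) / (\<Prod>w\<leftarrow>zs. (z - w)))"
  unfolding exp_divided_difference_def
  using assms by (intro divided_difference_eq pos_contour_enclosing_circlepath holomorphic_intros)

text \<open>The theorem in a complex variable s, with D = F'(s); for q + 1 nodes the coefficient
  \<open>length zs - 1\<close> is q.\<close>

lemma exp_divided_difference_deriv:
  obtains D where
    "((\<lambda>s. exp_divided_difference s zs) has_field_derivative D) (at s)"
    "(\<Sum>w\<leftarrow>zs. w * exp_divided_difference s (zs @ [w])) =
       s * D - (of_nat (length zs) - 1) * exp_divided_difference s zs"
proof -
  obtain r where r: "0 < r" "set zs \<subseteq> ball 0 r"
    using bounded_subset_ballD[OF finite_imp_bounded[OF finite_set], of zs 0] by blast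
  let ?\<gamma> = "circlepath 0 r"
  let ?P = "\<lambda>z. \<Prod>w\<leftarrow>zs. (z - w)"
  let ?A = "contour_integral ?\<gamma> (\<lambda>z. exp (s * z) / ?P z)"
  let ?B = "contour_integral ?\<gamma> (\<lambda>z. z * exp (s * z) / ?P z)"
  let ?C = "\<lambda>w. contour_integral ?\<gamma> (\<lambda>z. exp (s * z) / (?P z * (z - w)))"
  have off: "z \<notin> set zs" if "z \<in> path_image ?\<gamma>" for z
    using that r by auto
  then have P0: "?P z \<noteq> 0" if "z \<in> path_image ?\<gamma>" for z
    using that by (auto simp: prod_list_zero_iff)
  have P: "continuous_on (path_image ?\<gamma>) ?P"
    using has_field_derivative_prod_list_diff[OF off]
    by (meson DERIV_isCont continuous_at_imp_continuous_on)
  have "((\<lambda>s. contour_integral ?\<gamma> (\<lambda>z. exp (s * z) * (1 / ?P z))) has_field_derivative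
      contour_integral ?\<gamma> (\<lambda>z. z * exp (s * z) * (1 / ?P z))) (at s)"
    using P P0 by (intro has_field_derivative_contour_integral_exp continuous_intros) auto
  then have deriv: "((\<lambda>s. exp_divided_difference s zs) has_field_derivative
      1 / (2 * of_real pi * \<i>) * ?B) (at s)"
    unfolding exp_divided_difference_circlepath[OF r] by (intro DERIV_cmult) simp
  have A: "((\<lambda>z. exp (s * z) / ?P z) has_contour_integral ?A) ?\<gamma>"
    using P P0 by (intro has_contour_integral_integral contour_integrable_continuous_circlepath
        continuous_intros) auto
  have B: "((\<lambda>z. z * exp (s * z) / ?P z) has_contour_integral ?B) ?\<gamma>"
    using P P0 by (intro has_contour_integral_integral contour_integrable_continuous_circlepath
        continuous_intros) auto
  have C: "((\<lambda>z. exp (s * z) / (?P z * (z - w))) has_contour_integral ?C w) ?\<gamma>"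
    if "w \<in> set zs" for w
    using P P0 off that by (intro has_contour_integral_integral
        contour_integrable_continuous_circlepath continuous_intros) auto
  \<comment> \<open>The primitive is differentiated on the circle alone, where P has no zeros; the
    circle is closed, so the integral vanishes.\<close>
  have int_0: "((\<lambda>z. exp (s * z) / ?P z * (1 + s * z - z * (\<Sum>w\<leftarrow>zs. 1 / (z - w))))
      has_contour_integral 0) ?\<gamma>"
  proof (rule Cauchy_theorem_primitive)
    fix z assume z: "z \<in> path_image ?\<gamma>"
    show "((\<lambda>z. z * exp (s * z) / ?P z) has_field_derivative
        exp (s * z) / ?P z * (1 + s * z - z * (\<Sum>w\<leftarrow>zs. 1 / (z - w))))
        (at z within path_image ?\<gamma>)"
      by (rule derivative_eq_intros refl
          has_field_derivative_at_within[OF has_field_derivative_prod_list_diff[OF off[OF z]]] P0[OF z])+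
        (use P0[OF z] in \<open>simp add: field_simps\<close>)
  qed auto
  \<comment> \<open>The integrand of \<open>int_0\<close>, regrouped so that its integral is a
    combination of F, F' and the extended divided differences, up to the factor 2 pi i.\<close>
  have int_sum: "((\<lambda>z. (1 - of_nat (length zs)) * (exp (s * z) / ?P z) +
        s * (z * exp (s * z) / ?P z) - (\<Sum>w\<leftarrow>zs. w * (exp (s * z) / (?P z * (z - w)))))
      has_contour_integral (1 - of_nat (length zs)) * ?A + s * ?B - (\<Sum>w\<leftarrow>zs. w * ?C w)) ?\<gamma>"
    using A B C by (intro has_contour_integral_diff has_contour_integral_add
        has_contour_integral_lmul has_contour_integral_sum_list)
  have eq: "(1 - of_nat (length zs)) * (exp (s * z) / ?P z) +
        s * (z * exp (s * z) / ?P z) - (\<Sum>w\<leftarrow>zs. w * (exp (s * z) / (?P z * (z - w)))) =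
      exp (s * z) / ?P z * (1 + s * z - z * (\<Sum>w\<leftarrow>zs. 1 / (z - w)))"
    if "z \<in> path_image ?\<gamma>" for z
  proof -
    \<comment> \<open>P itself depends on \<open>zs\<close>, so the induction runs over a separate
      list \<open>ws\<close> with \<open>p\<close> fixed. Each w/(z - w) = z/(z - w) - 1 adds one
      -1, in total -\<open>length ws\<close>.\<close>
    have "(\<Sum>w\<leftarrow>ws. w * (E / (p * (z - w)))) =
        E / p * (z * (\<Sum>w\<leftarrow>ws. 1 / (z - w)) - of_nat (length ws))"
      if "z \<notin> set ws" "p \<noteq> 0" for E p ws
      using that
    proof (induction ws)
      case (Cons a ws)
      have "a * (E / (p * (z - a))) = E / p * (z * (1 / (z - a)) - 1)"
        using Cons.prems by (auto simp: field_simps)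
      moreover have "(\<Sum>w\<leftarrow>ws. w * (E / (p * (z - w)))) =
          E / p * (z * (\<Sum>w\<leftarrow>ws. 1 / (z - w)) - of_nat (length ws))"
        using Cons by simp
      ultimately show ?case
        by (simp only: list.map sum_list.Cons length_Cons of_nat_Suc) (simp add: algebra_simps)
    qed simp
    then have "(\<Sum>w\<leftarrow>zs. w * (exp (s * z) / (?P z * (z - w)))) =
        exp (s * z) / ?P z * (z * (\<Sum>w\<leftarrow>zs. 1 / (z - w)) - of_nat (length zs))"
      using off[OF that] P0[OF that] by blast
    moreover have "(1 - n) * (E / p) + s * (z * E / p) - E / p * (z * S - n) =
        E / p * (1 + s * z - z * S)" for n E p S :: complex
      by (simp add: algebra_simps add_divide_distrib diff_divide_distrib)
    ultimately show ?thesis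
      by (simp only:)
  qed
  have "(1 - of_nat (length zs)) * ?A + s * ?B - (\<Sum>w\<leftarrow>zs. w * ?C w) = 0"
    by (rule has_contour_integral_unique[OF has_contour_integral_eq[OF int_sum eq] int_0])
  moreover have "(\<Sum>w\<leftarrow>zs. w * exp_divided_difference s (zs @ [w])) =
      1 / (2 * of_real pi * \<i>) * (\<Sum>w\<leftarrow>zs. w * ?C w)"
  proof -
    \<comment> \<open>Appending a node already present keeps all nodes in the ball, so the same
      circle applies, and P gains the factor z - w.\<close>
    have "w * exp_divided_difference s (zs @ [w]) = 1 / (2 * of_real pi * \<i>) * (w * ?C w)"
      if "w \<in> set zs" for w
      using exp_divided_difference_circlepath[OF r(1), of "zs @ [w]" 0 s] r(2) that by auto
    then show ?thesis
      by (simp only: sum_list_const_mult[symmetric] cong: map_cong)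
  qed
  ultimately show thesis
    by (intro that[OF deriv]) (simp add: exp_divided_difference_circlepath[OF r] field_simps)
qed

theorem theorem7:
  fixes q :: nat and x :: "nat \<Rightarrow> complex" and \<tau> :: real
  shows "(\<lambda>t::real. exp_divided_difference (- complex_of_real t) (map x [0..<Suc q]))
           differentiable (at \<tau>) \<and>
    (\<Sum>j=0..q. x j * exp_divided_difference (- complex_of_real \<tau>) (map x [0..<Suc q] @ [x j])) =
    complex_of_real \<tau> *
      vector_derivative (\<lambda>t::real. exp_divided_difference (- complex_of_real t) (map x [0..<Suc q])) (at \<tau>)
    - of_nat q * exp_divided_difference (- complex_of_real \<tau>) (map x [0..<Suc q])"
proof -
  let ?zs = "map x [0..<Suc q]"
  obtain D where
    D: "((\<lambda>s. exp_divided_difference s ?zs) has_field_derivative D) (at (- complex_of_real \<tau>))"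
    and eq: "(\<Sum>w\<leftarrow>?zs. w * exp_divided_difference (- complex_of_real \<tau>) (?zs @ [w])) =
      - complex_of_real \<tau> * D -
        (of_nat (length ?zs) - 1) * exp_divided_difference (- complex_of_real \<tau>) ?zs"
    by (rule exp_divided_difference_deriv)
  \<comment> \<open>With s = -\<tau> the chain rule gives the \<tau>-derivative -D, so s D = -\<tau>
    D is exactly \<tau> times that derivative.\<close>
  have "((\<lambda>t::real. - complex_of_real t) has_vector_derivative - 1) (at \<tau>)"
    by (auto intro!: derivative_eq_intros)
  from field_vector_diff_chain_at[OF this D]
  have vd: "((\<lambda>t::real. exp_divided_difference (- complex_of_real t) ?zs)
      has_vector_derivative - D) (at \<tau>)"
    by (simp add: o_def)
  \<comment> \<open>The list sum runs over occurrences, hence over indices j, even when some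
    \<open>x j\<close> coincide.\<close>
  have "(\<Sum>w\<leftarrow>?zs. w * exp_divided_difference (- complex_of_real \<tau>) (?zs @ [w])) =
      (\<Sum>j=0..q. x j * exp_divided_difference (- complex_of_real \<tau>) (?zs @ [x j]))"
    unfolding map_map o_def interv_sum_list_conv_sum_set_nat set_upt
    by (simp only: atLeastLessThanSuc_atLeastAtMost)
  with eq vd show ?thesis
    by (auto simp: vector_derivative_at differentiableI_vector simp del: upt_Suc)
qed

end
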